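(* Let $\Sigma_{m,2,2}$ be the sign pattern of degree $d=m+3$ (so $n=q=2$). For this sign pattern, the triples $(u,v,w)$ under consideration are the triples of non-negative integers with $u+v+w=d-2=m+1$. (1) Suppose that $d\geq 7$. If the couple $(\Sigma_{m,2,2},(u,v,w))$ is realizable, then $w\geq m-3$. For each fixed $d\geq 7$, there are exactly $15$ triples $(u,v,w)$ satisfying the condition $w\geq m-3$. (2) For $d\geq 6$, each of the $10$ triples $(u,v,w)$ with $u+v\leq 3$, as well as the triple $(0,4,m-3)$, is realizable with the sign pattern $\Sigma_{m,2,2}$. (3) For $d\geq 6$, none of the triples $(4,0,m-3)$, $(3,1,m-3)$, $(2,2,m-3)$ and $(1,3,m-3)$ is realizable with the sign pattern $\Sigma_{m,2,2}$.
   Context: A real univariate polynomial is called hyperbolic if all its roots are real. For a real polynomial $Q=\sum_{j=0}^d a_jx^j$ with all coefficients $a_j\neq 0$, its sign pattern is $\sigma(Q)=(\mathrm{sgn}(a_d),\mathrm{sgn}(a_{d-1}),\ldots,\mathrm{sgn}(a_0))$. For positive integers $m,n,q$ with $m+n+q=d+1$, $\Sigma_{m,n,q}$ denotes the sign pattern consisting of $m$ signs $+$ followed by $n$ signs $-$ followed by $q$ signs $+$. A degree $d$ hyperbolic polynomial with sign pattern $\Sigma_{m,n,q}$ has (by Descartes' rule of signs) exactly two positive and $d-2$ negative roots, counted with multiplicity. For non-negative integers $u,v,w$ with $u+v+w=d-2$, the couple $(\Sigma_{m,n,q},(u,v,w))$ is called realizable (equivalently, the triple $(u,v,w)$ is realizable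 with the sign pattern $\Sigma_{m,n,q}$) if there exists a degree $d$ hyperbolic polynomial $Q$ with $\sigma(Q)=\Sigma_{m,n,q}$, the moduli of all of whose roots are distinct, such that, denoting by $\beta<\alpha$ its positive roots and by $\gamma_1<\cdots<\gamma_{d-2}$ the moduli of its negative roots, and setting $\gamma_0:=0$ and $\gamma_{d-1}:=+\infty$, one has $\gamma_u<\beta<\gamma_{u+1}$ and $\gamma_{u+v}<\alpha<\gamma_{u+v+1}$. (That is, $u$ moduli of negative roots are smaller than $\beta$, $v$ lie between $\beta$ and $\alpha$, and $w$ are larger than $\alpha$.) *)

theory Defs
  imports
    "HOL-Computational_Algebra.Polynomial"
    "HOL-Library.Extended_Real"
    Complex_Main
begin

definition hyperbolic :: "real poly \<Rightarrow> bool" where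
  "hyperbolic Q \<longleftrightarrow> Q \<noteq> 0 \<and> (\<forall>z::complex. poly (map_poly of_real Q) z = 0 \<longrightarrow> z \<in> \<real>)"

text \<open>Signs are listed from the leading coefficient down to the constant term.\<close>

definition sign_pattern :: "real poly \<Rightarrow> real list" where
  "sign_pattern Q = map sgn (rev (coeffs Q))"

definition Sigma_pattern :: "nat \<Rightarrow> nat \<Rightarrow> nat \<Rightarrow> real list" where
  "Sigma_pattern m n q = replicate m 1 @ replicate n (-1) @ replicate q 1"

text \<open>The roots of a hyperbolic polynomial are taken with multiplicity, so that distinctness of
  their moduli also forces every root to be simple.\<close>

definition distinct_root_moduli :: "real poly \<Rightarrow> bool" where
  "distinct_root_moduli Q \<longleftrightarrow> rsquarefree Q \<and> inj_on abs {x. poly Q x = 0}"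

text \<open>The arguments \<open>m\<close>, \<open>n\<close>, \<open>q\<close> are meant to be positive. The sequence \<open>\<gamma>\<close> enumerates
  the moduli of the negative roots increasingly at the indices \<open>1, \<dots>, d - 2\<close>; it takes values
  in the extended reals because of the convention \<open>\<gamma> (d - 1) = \<infinity>\<close>.\<close>

definition realizable :: "nat \<Rightarrow> nat \<Rightarrow> nat \<Rightarrow> nat \<times> nat \<times> nat \<Rightarrow> bool" where
  "realizable m n q = (\<lambda>(u, v, w).
     let d = m + n + q - 1 in
       u + v + w = d - 2 \<and>
       (\<exists>Q :: real poly.
          degree Q = d \<and> hyperbolic Q \<and> sign_pattern Q = Sigma_pattern m n q \<and>
          distinct_root_moduli Q \<and>
          (\<exists>(\<beta>::real) (\<alpha>::real) (\<gamma> :: nat \<Rightarrow> ereal).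
             \<beta> < \<alpha> \<and> {x. poly Q x = 0 \<and> x > 0} = {\<beta>, \<alpha>} \<and>
             strict_mono_on {1..d - 2} \<gamma> \<and>
             \<gamma> ` {1..d - 2} = (\<lambda>x. ereal \<bar>x\<bar>) ` {x. poly Q x = 0 \<and> x < 0} \<and>
             \<gamma> 0 = 0 \<and> \<gamma> (d - 1) = \<infinity> \<and>
             \<gamma> u < ereal \<beta> \<and> ereal \<beta> < \<gamma> (u + 1) \<and>
             \<gamma> (u + v) < ereal \<alpha> \<and> ereal \<alpha> < \<gamma> (u + v + 1))))"

end

theory Submission imports Defs begin

text \<open>Put \<open>a = 1 / \<alpha> < b = 1 / \<beta>\<close> and let \<open>G\<close> be the set of the \<open>1 / \<gamma>\<^sub>i\<close>. Up to a positive factor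
  the polynomial is \<open>(1 - b x) (1 - a x) (\<Prod>g\<in>G. 1 + g x)\<close>; write \<open>c\<^sub>k\<close> for its coefficients.

  If five elements of \<open>G\<close> exceed \<open>a\<close>, then \<open>f = (1 - a x) (\<Prod>g\<in>G. 1 + g x)\<close> has
  \<open>f\<^sub>1, f\<^sub>2, f\<^sub>3 > 0\<close>, and \<open>c\<^sub>3 = f\<^sub>3 - b f\<^sub>2 < 0 < f\<^sub>4 - b f\<^sub>3 = c\<^sub>4\<close> gives \<open>f\<^sub>3 f\<^sub>3 < f\<^sub>2 f\<^sub>4\<close>,
  contradicting Newton's inequality. If four elements exceed \<open>a\<close> and one of them, \<open>g\<close>, exceeds \<open>b\<close>,
  then removing the factor \<open>1 + g x\<close> from \<open>f\<close> leaves \<open>h\<close> with \<open>h\<^sub>1, h\<^sub>2 > 0\<close>, and Newton's inequalities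
  for \<open>h\<close> contradict \<open>c\<^sub>2 < 0 < c\<^sub>4\<close>.

  Conversely, the remaining triples are realized by explicit polynomials of degree 6, and a
  realization survives multiplication by \<open>1 + \<epsilon> x\<close> with small \<open>\<epsilon> > 0\<close>, which raises \<open>m\<close> and \<open>w\<close> by 1.\<close>

subsection \<open>Newton's inequalities\<close>

text \<open>Counting distinct roots against the degree is the way "all roots real and simple" is
  expressed below. A linear factor raises the degree by exactly one and the number of roots by at
  most one, so the cofactor has its full number of roots too.\<close>

lemma card_roots_linear_factor:
  fixes q :: "real poly"
  assumes "q \<noteq> 0" "card {x. poly ([:-r, 1:] * q) x = 0} = degree ([:-r, 1:] * q)"
  shows "card {x. poly q x = 0} = degree q"
proof -
  have "{x. poly ([:-r, 1:] * q) x = 0} = insert r {x. poly q x = 0}" by auto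
  moreover have "degree ([:-r, 1:] * q) = Suc (degree q)"
    using assms(1) by (subst degree_mult_eq) auto
  ultimately have "Suc (degree q) \<le> Suc (card {x. poly q x = 0})"
    using assms(2) card_insert_le_m1 poly_roots_finite[OF assms(1)]
    by (metis card_insert_if le_SucI order_refl)
  with card_poly_roots_bound[OF assms(1)] show ?thesis by simp
qed

text \<open>Splitting off a root r, p = (x - r) q, gives p'^2 - p p'' = q^2 + (x - r)^2 (q'^2 - q
  q''), so nonnegativity passes from q to p.\<close>

lemma laguerre_inequality:
  fixes p :: "real poly"
  assumes "card {x. poly p x = 0} = degree p"
  shows "poly p x * poly (pderiv (pderiv p)) x \<le> (poly (pderiv p) x)\<^sup>2"
  using assms
proof (induction "degree p" arbitrary: p)
  case 0
  then have "pderiv p = 0" by (simp add: pderiv_eq_0_iff)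
  then show ?case by simp
next
  case (Suc n)
  then have "p \<noteq> 0" by auto
  from Suc have "{x. poly p x = 0} \<noteq> {}" by (metis card.empty nat.distinct(1))
  then obtain r where "poly p r = 0" by auto
  then obtain q where p: "p = [:-r, 1:] * q" using poly_eq_0_iff_dvd by (metis dvdE)
  with \<open>p \<noteq> 0\<close> have "q \<noteq> 0" by auto
  have "degree p = Suc (degree q)"
    unfolding p using \<open>q \<noteq> 0\<close> by (subst degree_mult_eq) auto
  then have "n = degree q" using Suc.hyps(2) by simp
  moreover have "card {x. poly q x = 0} = degree q"
    using card_roots_linear_factor \<open>q \<noteq> 0\<close> Suc.prems p by blast
  ultimately have IH: "poly q x * poly (pderiv (pderiv q)) x \<le> (poly (pderiv q) x)\<^sup>2"
    using Suc.hyps(1) by blast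
  have d: "pderiv p = q + [:-r, 1:] * pderiv q"
    unfolding p pderiv_mult by (simp add: pderiv_pCons)
  have d1: "poly (pderiv p) x = poly q x + (x - r) * poly (pderiv q) x"
    unfolding d by (simp add: algebra_simps)
  have dd: "pderiv (pderiv p) = pderiv q + (pderiv q + [:-r, 1:] * pderiv (pderiv q))"
    unfolding d pderiv_add pderiv_mult by (simp add: pderiv_pCons)
  have d2: "poly (pderiv (pderiv p)) x = 2 * poly (pderiv q) x + (x - r) * poly (pderiv (pderiv q)) x"
    unfolding dd by (simp add: algebra_simps)
  have "(poly (pderiv p) x)\<^sup>2 - poly p x * poly (pderiv (pderiv p)) x =
      (poly q x)\<^sup>2 + (x - r)\<^sup>2 * ((poly (pderiv q) x)\<^sup>2 - poly q x * poly (pderiv (pderiv q)) x)"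
    unfolding d1 d2 unfolding p by (simp add: algebra_simps power2_eq_square)
  also have "\<dots> \<ge> 0" using IH by simp
  finally show ?case by simp
qed

text \<open>Rolle's theorem between consecutive elements of \<open>S\<close>, added in increasing
  order. The bound \<open>x < Max S\<close> strengthens the induction: the critical point found
  above \<open>Max A\<close> differs from all earlier ones.\<close>

lemma rolle_roots:
  fixes p :: "real poly"
  assumes "finite S" "S \<noteq> {}" "\<And>x. x \<in> S \<Longrightarrow> poly p x = 0"
  shows "\<exists>T. finite T \<and> Suc (card T) = card S \<and> (\<forall>x\<in>T. x < Max S \<and> poly (pderiv p) x = 0)"
  using assms
proof (induction S rule: finite_linorder_max_induct)
  case empty
  then show ?case by simp
next
  case (insert b A)
  show ?case
  proof (cases "A = {}")
    case True
    then show ?thesis by (intro exI[of _ "{}"]) auto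
  next
    case False
    with insert obtain T where T: "finite T" "Suc (card T) = card A"
        "\<forall>x\<in>T. x < Max A \<and> poly (pderiv p) x = 0"
      by auto
    have MaxA: "Max A \<in> A" "Max A < b" using False insert.hyps by auto
    with insert.prems have "poly p (Max A) = 0" "poly p b = 0" by auto
    with poly_MVT[OF MaxA(2), of p] MaxA(2)
    obtain x where x: "Max A < x" "x < b" "poly (pderiv p) x = 0" by auto
    have "Max (insert b A) = b"
      using insert.hyps by (intro Max_eqI) (auto intro: less_imp_le)
    moreover have "x \<notin> T" using T(3) x(1) by force
    moreover have "b \<notin> A" using insert.hyps by auto
    ultimately show ?thesis
      using T x MaxA insert.hyps
      by (intro exI[of _ "insert x T"]) (auto intro: less_trans)
  qed
qed

lemma card_roots_pderiv:
  fixes p :: "real poly"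
  assumes "card {x. poly p x = 0} = degree p"
  shows "card {x. poly (pderiv p) x = 0} = degree (pderiv p)"
proof (cases "degree p = 0")
  case True
  then have "pderiv p = 0" by (simp add: pderiv_eq_0_iff)
  \<comment> \<open>The zero polynomial vanishes everywhere, and \<open>card\<close> of an infinite
    set is 0, which is also its degree.\<close>
  then show ?thesis by (simp add: infinite_UNIV_char_0)
next
  case False
  then have nz: "p \<noteq> 0" "pderiv p \<noteq> 0" by (auto simp: pderiv_eq_0_iff)
  let ?S = "{x. poly p x = 0}"
  have "?S \<noteq> {}" using False assms by (metis card.empty)
  then have "\<exists>T. finite T \<and> Suc (card T) = card ?S \<and> (\<forall>x\<in>T. x < Max ?S \<and> poly (pderiv p) x = 0)"
    by (intro rolle_roots poly_roots_finite nz) simp_all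
  then obtain T where T: "Suc (card T) = card ?S" "\<forall>x\<in>T. poly (pderiv p) x = 0" by blast
  then have "card T \<le> card {x. poly (pderiv p) x = 0}"
    by (intro card_mono poly_roots_finite nz) auto
  moreover have "degree (pderiv p) = card T" using T assms by (simp add: degree_pderiv)
  ultimately show ?thesis using card_poly_roots_bound[OF nz(2)] by simp
qed

text \<open>For k = 0 this is Laguerre's inequality at x = 0; larger k reduce to the derivative,
  whose roots are again all real and simple. The constants do not involve the degree, which makes
  this weaker than the sharp Newton inequality but strong enough for log-concavity.\<close>

lemma newton_inequality:
  fixes p :: "real poly"
  assumes "card {x. poly p x = 0} = degree p"
  shows "real (k + 2) * (coeff p k * coeff p (k + 2)) \<le> real (k + 1) * (coeff p (k + 1))\<^sup>2"
  using assms
proof (induction k arbitrary: p)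
  case 0
  then show ?case
    using laguerre_inequality[of p 0]
    by (simp add: poly_0_coeff_0 coeff_pderiv power2_eq_square numeral_2_eq_2 algebra_simps)
next
  case (Suc k)
  \<comment> \<open>The common factor that differentiation puts on both sides of the inequality for
    \<open>pderiv p\<close> at index k.\<close>
  let ?c = "real (k + 1) * real (k + 2)"
  have "?c * (real (k + 3) * (coeff p (k + 1) * coeff p (k + 3)))
      \<le> ?c * (real (k + 2) * (coeff p (k + 2))\<^sup>2)"
    using Suc.IH[OF card_roots_pderiv[OF Suc.prems]]
    by (simp add: coeff_pderiv power2_eq_square mult_ac numeral_3_eq_3)
  then have "real (k + 3) * (coeff p (k + 1) * coeff p (k + 3)) \<le> real (k + 2) * (coeff p (k + 2))\<^sup>2"
    by (subst (asm) mult_le_cancel_left_pos) auto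
  then show ?case by (simp add: numeral_3_eq_3 add_ac)
qed

lemma log_concave_coeffs:
  fixes p :: "real poly"
  assumes "card {x. poly p x = 0} = degree p"
  shows "coeff p k * coeff p (k + 2) \<le> (coeff p (k + 1))\<^sup>2"
proof (cases "coeff p k * coeff p (k + 2) \<le> 0")
  case True
  then show ?thesis by (rule order_trans) simp
next
  case False
  then have "real (k + 1) * (coeff p k * coeff p (k + 2)) \<le> real (k + 2) * (coeff p k * coeff p (k + 2))"
    by (intro mult_right_mono) auto
  also have "\<dots> \<le> real (k + 1) * (coeff p (k + 1))\<^sup>2" by (rule newton_inequality[OF assms])
  finally show ?thesis by (subst (asm) mult_le_cancel_left_pos) auto
qed

subsection \<open>Products of linear factors\<close>

text \<open>For finite \<open>T\<close> the coefficients are the elementary symmetric functions e_k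
  of \<open>T\<close>. With the constant term normalized to 1, the parameters are negated
  reciprocals of roots, and a factor with small t barely disturbs the existing coefficients.\<close>

definition unit_prod :: "real set \<Rightarrow> real poly" where
  "unit_prod T = (\<Prod>t\<in>T. [:1, t:])"

lemma unit_prod_empty [simp]: "unit_prod {} = 1"
  by (simp add: unit_prod_def)

lemma unit_prod_insert:
  "finite T \<Longrightarrow> t \<notin> T \<Longrightarrow> unit_prod (insert t T) = [:1, t:] * unit_prod T"
  by (simp add: unit_prod_def)

lemma coeff_linear_mult:
  fixes p :: "'a::comm_ring_1 poly"
  shows "coeff ([:1, t:] * p) 0 = coeff p 0"
    and "coeff ([:1, t:] * p) (Suc k) = coeff p (Suc k) + t * coeff p k"
  by simp_all

lemma coeff_unit_prod_insert:
  assumes "finite T" "t \<notin> T"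
  shows "coeff (unit_prod (insert t T)) (Suc k) = coeff (unit_prod T) (Suc k) + t * coeff (unit_prod T) k"
  unfolding unit_prod_insert[OF assms] by (rule coeff_linear_mult)

lemma coeff_unit_prod_0 [simp]: "coeff (unit_prod T) 0 = 1"
  by (induction T rule: infinite_finite_induct)
     (auto simp: unit_prod_insert coeff_linear_mult(1) simp del: mult_pCons_left, simp add: unit_prod_def)

lemma unit_prod_nz [simp]: "unit_prod T \<noteq> 0"
  by (metis coeff_unit_prod_0 coeff_0 zero_neq_one)

lemma degree_unit_prod:
  assumes "finite T" "0 \<notin> T"
  shows "degree (unit_prod T) = card T"
  using assms
proof (induction T rule: finite_induct)
  case (insert t T)
  then show ?case by (subst unit_prod_insert; (subst degree_mult_eq)?) auto
qed auto

lemma roots_unit_prod: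
  assumes "finite T" "0 \<notin> T"
  shows "{x. poly (unit_prod T) x = 0} = (\<lambda>t. - 1 / t) ` T"
proof -
  have "1 + x * t = 0 \<longleftrightarrow> x = - 1 / t" if "t \<in> T" for x t
    using that assms(2) by (cases "t = 0") (auto simp: field_simps)
  then show ?thesis
    using assms(1) by (auto simp: unit_prod_def poly_prod)
qed

lemma card_roots_unit_prod:
  assumes "finite T" "0 \<notin> T"
  shows "card {x. poly (unit_prod T) x = 0} = degree (unit_prod T)"
  unfolding roots_unit_prod[OF assms] degree_unit_prod[OF assms]
  by (rule card_image) (auto simp: inj_on_def)

lemma coeff_unit_prod_nonneg:
  assumes "\<And>g. g \<in> G \<Longrightarrow> 0 \<le> g"
  shows "0 \<le> coeff (unit_prod G) k"
  using assms
proof (induction G arbitrary: k rule: infinite_finite_induct)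
  case (insert g G)
  then show ?case by (cases k) (simp_all add: coeff_unit_prod_insert)
qed (simp_all add: unit_prod_def)

text \<open>Reduces positivity of low coefficients to a well-chosen subset of the factors.
  \<open>G\<close> and \<open>T\<close> may overlap, so the chosen elements need not be removed from
  \<open>G\<close> first.\<close>

lemma coeff_unit_prod_pos_Un:
  assumes "finite G" "finite T" "\<And>g. g \<in> G \<Longrightarrow> 0 \<le> g"
    and "\<And>i. i \<le> k \<Longrightarrow> 0 < coeff (unit_prod T) i"
  shows "\<forall>i\<le>k. 0 < coeff (unit_prod (G \<union> T)) i"
  using assms(1,3)
proof (induction G rule: finite_induct)
  case empty
  then show ?case using assms(4) by simp
next
  case (insert g G)
  show ?case
  proof (cases "g \<in> T")
    case True
    then have "insert g G \<union> T = G \<union> T" by auto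
    then show ?thesis using insert by simp
  next
    case False
    have "0 < coeff (unit_prod (insert g (G \<union> T))) i" if "i \<le> k" for i
    proof (cases i)
      case (Suc j)
      have "0 < coeff (unit_prod (G \<union> T)) i" "0 < coeff (unit_prod (G \<union> T)) j" "0 \<le> g"
        using insert that Suc by auto
      then show ?thesis
        using Suc False insert.hyps assms(2)
        by (simp add: coeff_unit_prod_insert add_pos_nonneg)
    qed simp
    then show ?thesis by simp
  qed
qed

subsection \<open>Obstructions to the sign pattern\<close>

lemma mult_sum_less:
  fixes a x y :: "'a::linordered_idom"
  assumes "a < x" "a < y" "0 < a"
  shows "a * (x + y) < 2 * (x * y)"
proof -
  have "a * x < y * x" "a * y < x * y"
    using assms by (auto intro!: mult_strict_right_mono)
  then show ?thesis by (simp add: algebra_simps)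
qed

text \<open>Take three elements above a. Multiplying by 1 - a x yields e_1 - a and e_2 - a e_1;
  summing \<open>mult_sum_less\<close> over the three pairs, where each element occurs twice, gives
  a e_1 < e_2.\<close>

lemma coeff_unit_prod_pos_three:
  assumes "finite G" "\<And>g. g \<in> G \<Longrightarrow> 0 < g" "0 < a" "3 \<le> card {g \<in> G. a < g}"
  shows "\<forall>i\<le>2. 0 < coeff (unit_prod (insert (-a) G)) i"
proof -
  obtain S where S: "S \<subseteq> {g \<in> G. a < g}" "card S = 3"
    using obtain_subset_with_card_n[OF assms(4)] by metis
  then obtain x y z where xyz: "S = {x, y, z}" "x \<noteq> y" "x \<noteq> z" "y \<noteq> z"
    by (auto simp: card_3_iff)
  then have gt: "a < x" "a < y" "a < z" using S(1) by auto
  have neg: "-a \<notin> {x, y, z}" using gt assms(3) by auto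
  have P: "unit_prod (insert (-a) S) = [:1, -a:] * ([:1, x:] * ([:1, y:] * [:1, z:]))"
    using xyz neg by (auto simp: unit_prod_insert simp del: mult_pCons_left mult_pCons_right)
  have "0 < coeff (unit_prod (insert (-a) S)) i" if "i \<le> 2" for i
    using that gt assms(3) unfolding P
    using mult_sum_less[OF gt(1,2) assms(3)] mult_sum_less[OF gt(1,3) assms(3)]
      mult_sum_less[OF gt(2,3) assms(3)]
    by (auto simp: le_Suc_eq numeral_2_eq_2 algebra_simps)
  then have "\<forall>i\<le>2. 0 < coeff (unit_prod (G \<union> insert (-a) S)) i"
    using assms(1,2) S(1) by (intro coeff_unit_prod_pos_Un) (auto simp: less_imp_le intro: finite_subset)
  moreover have "G \<union> insert (-a) S = insert (-a) G" using S(1) by auto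
  ultimately show ?thesis by simp
qed

text \<open>The same with five elements above a, where the third coefficient is e_3 - a e_2. Each
  pair lies in three of the ten triples, so summing the bounds over triples gives 3 a e_2 < 3 e_3.
  With n elements all close to a the comparison is between binomial(n,3) and binomial(n,2), hence
  the number five.\<close>

lemma coeff_unit_prod_pos_five:
  assumes "finite G" "\<And>g. g \<in> G \<Longrightarrow> 0 < g" "0 < a" "5 \<le> card {g \<in> G. a < g}"
  shows "\<forall>i\<le>3. 0 < coeff (unit_prod (insert (-a) G)) i"
proof -
  obtain S where S: "S \<subseteq> {g \<in> G. a < g}" "card S = 5"
    using obtain_subset_with_card_n[OF assms(4)] by metis
  have "finite S" using S(1) assms(1) by (auto intro: finite_subset)
  then obtain xs where xs: "set xs = S" "distinct xs" using finite_distinct_list by blast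
  then have "length xs = 5" using S(2) distinct_card by fastforce
  then obtain p q r s t where pqrst: "xs = [p, q, r, s, t]"
    by (auto simp: numeral_eq_Suc length_Suc_conv)
  then have gt: "a < p" "a < q" "a < r" "a < s" "a < t" using S(1) xs by auto
  have P: "unit_prod (insert (-a) S) =
      [:1, -a:] * ([:1, p:] * ([:1, q:] * ([:1, r:] * ([:1, s:] * [:1, t:]))))"
    using xs(2) gt assms(3) unfolding xs(1)[symmetric] pqrst
    by (auto simp: unit_prod_insert simp del: mult_pCons_left mult_pCons_right)
  note two = mult_sum_less[OF _ _ assms(3)]
  have three: "a * (x * y + x * z + y * z) < 3 * (x * y * z)" if "a < x" "a < y" "a < z" for x y z :: real
  proof -
    have "a * (x * y) < z * (x * y)" "a * (x * z) < y * (x * z)" "a * (y * z) < x * (y * z)"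
      using that assms(3) by (auto intro!: mult_strict_right_mono)
    then show ?thesis by (simp add: algebra_simps)
  qed
  have "0 < coeff (unit_prod (insert (-a) S)) i" if "i \<le> 3" for i
  proof -
    have "i = 0 \<or> i = 1 \<or> i = 2 \<or> i = 3" using that by arith
    then consider "i = 0" | "i = 1" | "i = 2" | "i = 3" by blast
    then show ?thesis
    proof cases
      case 2
      then show ?thesis using gt assms(3) unfolding P by simp
    next
      case 3
      \<comment> \<open>The ten pair bounds add up to 4 a e_1 < 2 e_2; positivity of a e_1 then
        allows weakening to a e_1 < e_2.\<close>
      have "0 < a * p" "0 < a * q" "0 < a * r" "0 < a * s" "0 < a * t"
        using gt assms(3) by auto
      then have "a * (p + q + r + s + t)
          < p * q + p * r + p * s + p * t + q * r + q * s + q * t + r * s + r * t + s * t"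
        using two[OF gt(1,2)] two[OF gt(1,3)] two[OF gt(1,4)] two[OF gt(1,5)] two[OF gt(2,3)]
          two[OF gt(2,4)] two[OF gt(2,5)] two[OF gt(3,4)] two[OF gt(3,5)] two[OF gt(4,5)]
        unfolding distrib_left by linarith
      with 3 show ?thesis
        unfolding P by (simp add: numeral_2_eq_2 algebra_simps)
    next
      case 4
      then show ?thesis
        using three[OF gt(1,2,3)] three[OF gt(1,2,4)] three[OF gt(1,2,5)] three[OF gt(1,3,4)]
          three[OF gt(1,3,5)] three[OF gt(1,4,5)] three[OF gt(2,3,4)] three[OF gt(2,3,5)]
          three[OF gt(2,4,5)] three[OF gt(3,4,5)]
        unfolding P by (simp add: numeral_3_eq_3 algebra_simps)
    qed simp
  qed
  then have "\<forall>i\<le>3. 0 < coeff (unit_prod (G \<union> insert (-a) S)) i"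
    using assms(1,2) \<open>finite S\<close> by (intro coeff_unit_prod_pos_Un) (auto simp: less_imp_le)
  moreover have "G \<union> insert (-a) S = insert (-a) G" using S(1) by auto
  ultimately show ?thesis by simp
qed

lemma card_above_small_le_4:
  fixes a b :: real
  assumes G: "finite G" "\<And>g. g \<in> G \<Longrightarrow> 0 < g" and ab: "0 < a" "a < b"
    and c: "coeff (unit_prod (insert (-b) (insert (-a) G))) 3 < 0"
      "0 < coeff (unit_prod (insert (-b) (insert (-a) G))) 4"
  shows "card {g \<in> G. a < g} \<le> 4"
proof (rule ccontr)
  assume "\<not> ?thesis"
  then have five: "5 \<le> card {g \<in> G. a < g}" by simp
  let ?T = "insert (-a) G"
  define f where "f = coeff (unit_prod ?T)"
  have T: "finite ?T" "0 \<notin> ?T" "-b \<notin> ?T" using G ab by force+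
  have pos: "0 < f 2" "0 < f 3"
    using coeff_unit_prod_pos_five[OF G ab(1) five] by (auto simp: f_def)
  have "f 3 < b * f 2" "b * f 3 < f 4"
    using c coeff_unit_prod_insert[OF T(1,3), of 2] coeff_unit_prod_insert[OF T(1,3), of 3]
    by (auto simp: f_def eval_nat_numeral)
  \<comment> \<open>Cross-multiplication by the positive \<open>f 3\<close> and \<open>f 2\<close>
    makes b f_2 f_3 the common middle term, which eliminates b.\<close>
  then have "f 3 * f 3 < b * f 2 * f 3" "b * f 3 * f 2 < f 4 * f 2"
    using pos by (simp_all only: mult_strict_right_mono)
  then have "f 3 * f 3 < f 2 * f 4" by (simp only: mult_ac)
  moreover have "f 2 * f 4 \<le> (f 3)\<^sup>2"
    using log_concave_coeffs[OF card_roots_unit_prod[OF T(1,2)], of 2] by (simp add: f_def)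
  ultimately show False by (simp add: power2_eq_square)
qed

lemma card_above_small_neq_4:
  fixes a b g :: real
  assumes G: "finite G" "\<And>g. g \<in> G \<Longrightarrow> 0 < g" and ab: "0 < a" "a < b" and g: "g \<in> G" "b < g"
    and c: "coeff (unit_prod (insert (-b) (insert (-a) G))) 2 < 0"
      "0 < coeff (unit_prod (insert (-b) (insert (-a) G))) 4"
  shows "card {g \<in> G. a < g} < 4"
proof (rule ccontr)
  assume "\<not> ?thesis"
  then have four: "4 \<le> card {g \<in> G. a < g}" by simp
  let ?H = "G - {g}"
  have "{h \<in> G. a < h} = insert g {h \<in> ?H. a < h}" using g ab by force
  with four have three: "3 \<le> card {h \<in> ?H. a < h}" using G(1) by auto
  let ?T = "insert (-a) ?H"
  define h where "h = coeff (unit_prod ?T)"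
  have T: "finite ?T" "0 \<notin> ?T" "-b \<notin> ?T" "g \<notin> insert (-b) ?T" using G ab g by force+
  have pos: "0 < h 1" "0 < h 2" and h0: "h 0 = 1"
    using coeff_unit_prod_pos_three[OF _ _ ab(1) three] G by (auto simp: h_def)
  have lc: "h k * h (k + 2) \<le> (h (k + 1))\<^sup>2" for k
    using log_concave_coeffs[OF card_roots_unit_prod[OF T(1,2)], of k] by (simp add: h_def)
  have lc0: "h 2 \<le> (h 1)\<^sup>2" and lc1: "h 1 * h 3 \<le> (h 2)\<^sup>2" and lc2: "h 2 * h 4 \<le> (h 3)\<^sup>2"
    using lc[of 0] lc[of 1] lc[of 2] h0 by (simp_all add: eval_nat_numeral)
  \<comment> \<open>Here (1 - b x)(1 + g x) = 1 + D x - E x^2, and b < g makes D positive. Then c_2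
    < 0 bounds E from below and c_4 > 0 bounds E h_2 from above; the bounds clash once h_3 <= h_1
    h_2 and h_4 <= h_2^2.\<close>
  define D where "D = g - b"
  define E where "E = g * b"
  have "0 < D" "0 < E" using g ab by (simp_all add: D_def E_def)
  have GT: "insert (-b) (insert (-a) G) = insert g (insert (-b) ?T)" using g by auto
  have expand: "coeff (unit_prod (insert (-b) (insert (-a) G))) (Suc (Suc k))
      = h (Suc (Suc k)) + D * h (Suc k) - E * h k" for k
    unfolding GT coeff_unit_prod_insert[OF finite.insertI[OF T(1)] T(4)] coeff_unit_prod_insert[OF T(1,3)]
    by (simp add: h_def D_def E_def algebra_simps)
  have c2: "h 2 + D * h 1 < E" and c4: "E * h 2 < h 4 + D * h 3"
    using c expand[of 0] expand[of 2] h0 by (simp_all add: eval_nat_numeral)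
  have h3_le: "h 3 \<le> h 1 * h 2"
  proof -
    have "h 1 * h 3 \<le> h 2 * h 2" using lc1 by (simp add: power2_eq_square)
    also have "\<dots> \<le> (h 1)\<^sup>2 * h 2" using lc0 pos by (intro mult_right_mono) auto
    finally show ?thesis using pos by (simp add: power2_eq_square mult.assoc)
  qed
  have "h 4 \<le> h 2 * h 2" if "0 < h 3"
  proof -
    have "h 2 * h 4 \<le> h 3 * h 3" using lc2 by (simp add: power2_eq_square)
    also have "\<dots> \<le> (h 1 * h 2) * h 3" using h3_le that by (intro mult_right_mono) auto
    also have "\<dots> = h 2 * (h 1 * h 3)" by (simp add: mult_ac)
    also have "\<dots> \<le> h 2 * (h 2 * h 2)" using lc1 pos by (simp add: power2_eq_square)
    finally show ?thesis using pos by simp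
  qed
  \<comment> \<open>Log-concavity of h does not exclude h_3 <= 0 < h_4. The coefficients e of the
    product without 1 - a x are nonnegative and log-concave, so e_3 <= a e_2 forces e_4 <= a e_3,
    that is h_4 <= 0, contradicting c_4 > 0.\<close>
  moreover have "0 < h 3"
  proof (rule ccontr)
    assume "\<not> 0 < h 3"
    define e where "e = coeff (unit_prod ?H)"
    have H: "finite ?H" "-a \<notin> ?H" "0 \<notin> ?H" using G ab by force+
    have h: "h (Suc k) = e (Suc k) - a * e k" for k
      unfolding h_def e_def coeff_unit_prod_insert[OF H(1,2)] by simp
    have e_nonneg: "0 \<le> e k" for k
      unfolding e_def using G by (intro coeff_unit_prod_nonneg) (auto simp: less_imp_le)
    have "0 < e 2" using pos(2) h[of 1] e_nonneg[of 1] ab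
      by (metis Suc_1 diff_gt_0_iff_gt le_less_trans less_imp_le mult_nonneg_nonneg)
    have "e 2 * e 4 \<le> e 3 * e 3"
      using log_concave_coeffs[OF card_roots_unit_prod[OF H(1,3)], of 2]
      by (simp add: e_def power2_eq_square)
    also have "\<dots> \<le> (a * e 2) * e 3"
      using \<open>\<not> 0 < h 3\<close> h[of 2] e_nonneg by (intro mult_right_mono) auto
    finally have "e 4 \<le> a * e 3" using \<open>0 < e 2\<close> by (simp add: mult_ac)
    then have "h 4 \<le> 0" using h[of 3] by simp
    moreover have "D * h 3 \<le> 0" using \<open>0 < D\<close> \<open>\<not> 0 < h 3\<close> by (simp add: mult_le_0_iff)
    moreover have "0 < E * h 2" using \<open>0 < E\<close> pos by simp
    ultimately show False using c4 by simp
  qed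
  moreover have "(h 2 + D * h 1) * h 2 \<le> E * h 2" using c2 pos by (intro mult_right_mono) auto
  ultimately have "D * h 3 \<le> D * (h 1 * h 2)" "h 4 \<le> h 2 * h 2" "h 2 * h 2 + D * (h 1 * h 2) \<le> E * h 2"
    using \<open>0 < D\<close> h3_le by (auto simp: algebra_simps)
  with c4 show False by simp
qed

subsection \<open>Realizability in terms of reciprocal moduli\<close>

text \<open>A double root would still be a root of the quotient by its linear factor, which would
  then have more roots than its degree allows.\<close>

lemma rsquarefree_if_card_roots:
  fixes p :: "real poly"
  assumes "p \<noteq> 0" "card {x. poly p x = 0} = degree p"
  shows "rsquarefree p"
  unfolding rsquarefree_roots
proof (intro allI notI, elim conjE)
  fix a assume a: "poly p a = 0" "poly (pderiv p) a = 0"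
  then obtain q where p: "p = [:-a, 1:] * q" using poly_eq_0_iff_dvd by (metis dvdE)
  with assms(1) have "q \<noteq> 0" by auto
  have "pderiv p = q + [:-a, 1:] * pderiv q"
    unfolding p pderiv_mult by (simp add: pderiv_pCons)
  then have "poly (pderiv p) a = poly q a + poly ([:-a, 1:] * pderiv q) a"
    by (metis poly_add)
  with a(2) have "poly q a = 0" by simp
  then have "{x. poly p x = 0} = {x. poly q x = 0}" unfolding p by auto
  then have "degree p \<le> degree q" using assms(2) card_poly_roots_bound[OF \<open>q \<noteq> 0\<close>] by simp
  moreover have "degree p = Suc (degree q)"
    unfolding p using \<open>q \<noteq> 0\<close> by (subst degree_mult_eq) auto
  ultimately show False by simp
qed

lemma hyperbolic_unit_prod:
  assumes "finite T"
  shows "hyperbolic (unit_prod T)"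
  unfolding hyperbolic_def
proof (intro conjI allI impI)
  fix z :: complex assume z: "poly (map_poly of_real (unit_prod T)) z = 0"
  have lin: "map_poly complex_of_real ([:1, t:] * p) = [:1, of_real t:] * map_poly of_real p" for t p
  proof (rule poly_eqI)
    fix k show "coeff (map_poly complex_of_real ([:1, t:] * p)) k = coeff ([:1, of_real t:] * map_poly of_real p) k"
      by (cases k) (simp_all add: coeff_map_poly)
  qed
  have "poly (map_poly of_real (unit_prod T)) z = (\<Prod>t\<in>T. 1 + z * of_real t)"
    using assms
  proof (induction T rule: finite_induct)
    case (insert t T)
    then show ?case unfolding unit_prod_insert[OF insert.hyps] lin by (simp add: insert.hyps algebra_simps)
  qed simp
  with z obtain t where t: "1 + z * of_real t = 0"
    using assms by auto
  then have "of_real t \<noteq> (0 :: complex)" by auto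
  with t have "z = of_real (- 1 / t)" by (simp add: field_simps add_eq_0_iff)
  then show "z \<in> \<real>" by (metis Reals_of_real)
qed simp

text \<open>Read from the constant term upwards, the pattern has its two minus signs at indices 2
  and 3 whatever m is. The degree fixes the lengths of the compared lists.\<close>

lemma sign_pattern_eq_iff:
  assumes "degree Q = m + 3"
  shows "sign_pattern Q = Sigma_pattern m 2 2 \<longleftrightarrow>
    (\<forall>k<m + 4. sgn (coeff Q k) = (if k = 2 \<or> k = 3 then -1 else 1))"
proof -
  have "Q \<noteq> 0" using assms by auto
  have len: "length (coeffs Q) = m + 4" using \<open>Q \<noteq> 0\<close> assms by (simp add: length_coeffs)
  define L where "L = [1, 1, -1, -1] @ replicate m (1 :: real)"
  have L: "L ! k = (if k = 2 \<or> k = 3 then -1 else 1)" if "k < m + 4" for k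
    using that by (auto simp: L_def nth_append nth_Cons' numeral_2_eq_2 numeral_3_eq_3)
  have "Sigma_pattern m 2 2 = rev L"
    by (simp add: Sigma_pattern_def L_def numeral_2_eq_2)
  then have "sign_pattern Q = Sigma_pattern m 2 2 \<longleftrightarrow> map sgn (coeffs Q) = L"
    by (simp add: sign_pattern_def rev_map[symmetric])
  also have "\<dots> \<longleftrightarrow> (\<forall>k<m + 4. map sgn (coeffs Q) ! k = L ! k)"
    using len by (auto simp: list_eq_iff_nth_eq L_def)
  also have "\<dots> \<longleftrightarrow> (\<forall>k<m + 4. sgn (coeff Q k) = (if k = 2 \<or> k = 3 then -1 else 1))"
    using len L assms \<open>Q \<noteq> 0\<close> by (auto simp: coeffs_nth)
  finally show ?thesis .
qed

section \<open>Position of a number in an increasing sequence as a count\<close>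

text \<open>Turns the two-sided bounds of \<open>realizable\<close> into a cardinality. The bounds
  are required only at indices inside {1..n}, since the conventional values at 0 and n + 1 lie
  outside the monotone range.\<close>

lemma card_strict_mono_below:
  fixes f :: "nat \<Rightarrow> 'a::linorder"
  assumes "strict_mono_on {1..n} f" "u \<le> n"
    and "1 \<le> u \<Longrightarrow> f u < c" "u < n \<Longrightarrow> c < f (u + 1)"
  shows "card {i \<in> {1..n}. f i < c} = u"
proof -
  have "f i < c \<longleftrightarrow> i \<le> u" if "i \<in> {1..n}" for i
  proof (cases "i \<le> u")
    case True
    with that assms(1,2) have "f i \<le> f u"
      by (intro strict_mono_on_leD[OF assms(1)]) auto
    then show ?thesis using True that assms(3) by auto
  next
    case False
    with that assms(1) have "f (u + 1) \<le> f i"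
      by (intro strict_mono_on_leD[OF assms(1)]) auto
    then show ?thesis using False that assms(4) by auto
  qed
  then have "{i \<in> {1..n}. f i < c} = {1..u}" using assms(2) by auto
  then show ?thesis by simp
qed

lemma strict_mono_below_card:
  fixes f :: "nat \<Rightarrow> 'a::linorder"
  assumes "strict_mono_on {1..n} f" "\<And>i. i \<in> {1..n} \<Longrightarrow> f i \<noteq> c"
    and "card {i \<in> {1..n}. f i < c} = u"
  shows "1 \<le> u \<Longrightarrow> f u < c" "u < n \<Longrightarrow> c < f (u + 1)"
proof -
  have "u \<le> n" using card_mono[of "{1..n}" "{i \<in> {1..n}. f i < c}"] unfolding assms(3) by fastforce
  show "f u < c" if "1 \<le> u"
  proof (rule ccontr)
    assume "\<not> f u < c"
    then have "f i < c \<longrightarrow> i < u" if "i \<in> {1..n}" for i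
      using strict_mono_on_leD[OF assms(1), of u i] \<open>u \<le> n\<close> \<open>1 \<le> u\<close> that
      by (metis atLeastAtMost_iff not_less le_less_trans)
    then have "{i \<in> {1..n}. f i < c} \<subseteq> {1..<u}" by auto
    from card_mono[OF _ this] have "u \<le> card {1..<u}" unfolding assms(3) by simp
    then show False using that by simp
  qed
  show "c < f (u + 1)" if "u < n"
  proof (rule ccontr)
    assume "\<not> c < f (u + 1)"
    then have lt: "f (u + 1) < c" using assms(2)[of "u + 1"] that by auto
    have "{1..u + 1} \<subseteq> {i \<in> {1..n}. f i < c}"
    proof
      fix i assume i: "i \<in> {1..u + 1}"
      with that have "f i \<le> f (u + 1)" by (intro strict_mono_on_leD[OF assms(1)]) auto
      with lt i that show "i \<in> {i \<in> {1..n}. f i < c}" by auto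
    qed
    from card_mono[OF _ this] show False using assms(3) by simp
  qed
qed

lemma strict_mono_enumeration:
  fixes S :: "'a::linorder set"
  assumes "finite S"
  shows "\<exists>f. strict_mono_on {1..card S} f \<and> f ` {1..card S} = S"
  using assms
proof (induction S rule: finite_linorder_max_induct)
  case (insert b A)
  then obtain f where f: "strict_mono_on {1..card A} f" "f ` {1..card A} = A" by blast
  let ?f = "f(Suc (card A) := b)"
  have card: "card (insert b A) = Suc (card A)" using insert.hyps by auto
  have "?f ` {1..card A} = f ` {1..card A}" by (intro image_cong) auto
  then have "?f ` {1..Suc (card A)} = insert b A"
    using f(2) by (simp add: atLeastAtMostSuc_conv del: fun_upd_apply) simp
  moreover have "strict_mono_on {1..Suc (card A)} ?f"
  proof (rule strict_mono_onI)
    fix i j assume ij: "i \<in> {1..Suc (card A)}" "j \<in> {1..Suc (card A)}" "i < j"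
    then have "i \<in> {1..card A}" by auto
    then have "f i < b" using f(2) insert.hyps by blast
    then show "?f i < ?f j" using ij strict_mono_onD[OF f(1), of i j] by auto
  qed
  ultimately show ?case unfolding card by blast
qed simp

text \<open>Taking reciprocals reverses the order: moduli below the smaller positive root become
  elements above b, and moduli below the larger one become elements above a. Counts replace the
  enumeration, and w is left to be determined by the sum.\<close>

definition realizing :: "nat \<Rightarrow> nat \<Rightarrow> nat \<Rightarrow> real \<Rightarrow> real \<Rightarrow> real set \<Rightarrow> bool" where
  "realizing m u v a b G \<longleftrightarrow>
     0 < a \<and> a < b \<and> finite G \<and> card G = m + 1 \<and> (\<forall>g\<in>G. 0 < g) \<and> a \<notin> G \<and> b \<notin> G \<and>
     card {g \<in> G. b < g} = u \<and> card {g \<in> G. a < g} = u + v \<and>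
     sign_pattern (unit_prod (insert (-b) (insert (-a) G))) = Sigma_pattern m 2 2"

lemma realizable_imp_realizing:
  assumes "realizable m 2 2 (u, v, w)"
  shows "u + v + w = m + 1 \<and> (\<exists>a b G. realizing m u v a b G)"
proof -
  have d: "m + 2 + 2 - 1 = m + 3" "m + 3 - 2 = m + 1" "m + 3 - 1 = m + 2" by simp_all
  from assms show ?thesis
    unfolding realizable_def Let_def prod.case d
  proof (elim conjE exE)
    fix Q :: "real poly" and \<beta> \<alpha> :: real and \<gamma> :: "nat \<Rightarrow> ereal"
    assume uvw: "u + v + w = m + 1"
      and deg: "degree Q = m + 3" and sgnQ: "sign_pattern Q = Sigma_pattern m 2 2"
      and dist: "distinct_root_moduli Q"
      and ba: "\<beta> < \<alpha>" and posr: "{x. poly Q x = 0 \<and> x > 0} = {\<beta>, \<alpha>}"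
      and mono: "strict_mono_on {1..m + 1} \<gamma>"
      and img: "\<gamma> ` {1..m + 1} = (\<lambda>x. ereal \<bar>x\<bar>) ` {x. poly Q x = 0 \<and> x < 0}"
      and \<gamma>: "\<gamma> u < ereal \<beta>" "ereal \<beta> < \<gamma> (u + 1)" "\<gamma> (u + v) < ereal \<alpha>" "ereal \<alpha> < \<gamma> (u + v + 1)"
    define N where "N = {x. poly Q x = 0 \<and> x < 0}"
    define G where "G = (\<lambda>x. - 1 / x) ` N"
    define R where "R = {x. poly Q x = 0}"
    have "Q \<noteq> 0" using deg by auto
    have coeffs: "\<forall>k<m + 4. sgn (coeff Q k) = (if k = 2 \<or> k = 3 then -1 else 1)"
      using sgnQ sign_pattern_eq_iff[OF deg] by simp
    have c0: "0 < coeff Q 0" using coeffs by (auto simp: sgn_1_pos dest: spec[of _ 0])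
    have "0 \<notin> R" using c0 by (auto simp: R_def poly_0_coeff_0)
    have pos: "0 < \<beta>" "0 < \<alpha>" using posr by blast+
    have "R = {x. poly Q x = 0 \<and> x > 0} \<union> N"
    proof (rule set_eqI)
      fix x show "x \<in> R \<longleftrightarrow> x \<in> {x. poly Q x = 0 \<and> x > 0} \<union> N"
        using \<open>0 \<notin> R\<close> by (cases x "0 :: real" rule: linorder_cases) (auto simp: R_def N_def)
    qed
    then have R: "R = insert \<beta> (insert \<alpha> N)" unfolding posr by simp
    have finN: "finite N" using poly_roots_finite[OF \<open>Q \<noteq> 0\<close>] by (auto simp: N_def)
    have inj_abs: "inj_on (\<lambda>x. ereal \<bar>x\<bar>) N" by (auto simp: inj_on_def N_def)
    have inj_\<gamma>: "inj_on \<gamma> {1..m + 1}" using mono by (rule strict_mono_on_imp_inj_on)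
    have cardN: "card N = m + 1"
      using card_image[OF inj_abs] card_image[OF inj_\<gamma>] img by (simp add: N_def)
    have inj_inv: "inj_on (\<lambda>x. - 1 / x) N" by (auto simp: inj_on_def N_def)
    have cardG: "card G = m + 1" unfolding G_def using card_image[OF inj_inv] cardN by simp
    have Gpos: "\<forall>g\<in>G. 0 < g" by (auto simp: G_def N_def)
    \<comment> \<open>Otherwise c and -c would both be roots, against the distinctness of the
      moduli.\<close>
    have notin: "1 / c \<notin> G" if "c \<in> {\<beta>, \<alpha>}" for c
    proof
      assume "1 / c \<in> G"
      then obtain x where x: "x \<in> N" "1 / c = - 1 / x" unfolding G_def by blast
      then have "c = - x" using that pos by (auto simp: N_def nonzero_eq_divide_eq nonzero_divide_eq_eq)
      moreover have "c \<in> R" "x \<in> R" using x that R by auto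
      moreover have "inj_on abs R" using dist by (simp add: distinct_root_moduli_def R_def)
      ultimately have "c = x" using inj_onD[of abs R c x] by simp
      then show False using x that pos by (auto simp: N_def)
    qed
    have count: "card {g \<in> G. 1 / c < g} = k"
      if "0 < c" "k \<le> m + 1" "\<gamma> k < ereal c" "ereal c < \<gamma> (k + 1)" for c k
    proof -
      have "{g \<in> G. 1 / c < g} = (\<lambda>x. - 1 / x) ` {x \<in> N. \<bar>x\<bar> < c}"
        using that(1) by (auto simp: G_def N_def field_simps)
      then have "card {g \<in> G. 1 / c < g} = card {x \<in> N. \<bar>x\<bar> < c}"
        using inj_inv by (simp add: card_image inj_on_subset)
      also have "\<dots> = card ((\<lambda>x. ereal \<bar>x\<bar>) ` {x \<in> N. \<bar>x\<bar> < c})"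
        using inj_abs by (simp add: card_image inj_on_subset)
      also have "(\<lambda>x. ereal \<bar>x\<bar>) ` {x \<in> N. \<bar>x\<bar> < c} = {y \<in> (\<lambda>x. ereal \<bar>x\<bar>) ` N. y < ereal c}" by auto
      also have "\<dots> = \<gamma> ` {i \<in> {1..m + 1}. \<gamma> i < ereal c}"
        unfolding N_def img[symmetric] by blast
      also have "card \<dots> = card {i \<in> {1..m + 1}. \<gamma> i < ereal c}"
        using inj_\<gamma> by (intro card_image inj_on_subset[OF inj_\<gamma>]) auto
      also have "\<dots> = k" using mono that by (intro card_strict_mono_below) auto
      finally show ?thesis .
    qed
    define T where "T = insert (- (1 / \<beta>)) (insert (- (1 / \<alpha>)) G)"
    have T: "T = (\<lambda>x. - 1 / x) ` R" by (simp add: T_def R G_def)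
    have finR: "finite R" unfolding R using finN by simp
    have T': "finite T" "0 \<notin> T" unfolding T using finR \<open>0 \<notin> R\<close> by auto
    have "\<alpha> \<notin> N" "\<beta> \<notin> insert \<alpha> N" using ba pos by (auto simp: N_def)
    then have cardR: "card R = m + 3" using finN cardN by (simp add: R)
    have cardT: "card T = m + 3"
      unfolding T using cardR \<open>0 \<notin> R\<close> by (subst card_image) (auto simp: inj_on_def)
    \<comment> \<open>Both sides have degree m + 3 and agree at the m + 3 roots and at 0, hence at m
      + 4 points.\<close>
    have Q: "Q = smult (coeff Q 0) (unit_prod T)"
    proof (rule poly_eqI_degree[of "insert 0 R"])
      fix x assume "x \<in> insert 0 R"
      then show "poly Q x = poly (smult (coeff Q 0) (unit_prod T)) x"
      proof
        assume "x = 0"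
        then show ?thesis by (simp add: poly_0_coeff_0)
      next
        assume "x \<in> R"
        then have "x \<in> (\<lambda>t. - 1 / t) ` T" using \<open>0 \<notin> R\<close> unfolding T by (force simp: image_iff)
        then have "poly (unit_prod T) x = 0" using roots_unit_prod[OF T'] by auto
        then show ?thesis using \<open>x \<in> R\<close> by (simp add: R_def)
      qed
    qed (use finR \<open>0 \<notin> R\<close> cardR deg c0 cardT degree_unit_prod[OF T'] in auto)
    have "sgn (coeff Q k) = sgn (coeff (unit_prod T) k)" for k
      using c0 by (subst Q) (simp add: sgn_mult)
    then have "sign_pattern (unit_prod T) = Sigma_pattern m 2 2"
      using coeffs sign_pattern_eq_iff[of "unit_prod T" m] degree_unit_prod[OF T'] cardT by simp
    then have "realizing m u v (1 / \<alpha>) (1 / \<beta>) G"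
      unfolding realizing_def T_def
      using pos ba finN cardG Gpos notin count[of \<beta> u] count[of \<alpha> "u + v"] \<gamma> uvw
      by (auto simp: G_def frac_less2)
    then show ?thesis using uvw by blast
  qed
qed

lemma realizing_imp_realizable:
  assumes "realizing m u v a b G" "u + v + w = m + 1"
  shows "realizable m 2 2 (u, v, w)"
proof -
  from assms(1) have ab: "0 < a" "a < b" and G: "finite G" "card G = m + 1" "\<forall>g\<in>G. 0 < g" "a \<notin> G" "b \<notin> G"
    and u: "card {g \<in> G. b < g} = u" and v: "card {g \<in> G. a < g} = u + v"
    and sgns: "sign_pattern (unit_prod (insert (-b) (insert (-a) G))) = Sigma_pattern m 2 2"
    by (auto simp: realizing_def)
  define T where "T = insert (-b) (insert (-a) G)"
  define Q where "Q = unit_prod T"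
  have T: "finite T" "0 \<notin> T" using G ab by (auto simp: T_def)
  have "-a \<notin> G" "-b \<notin> insert (-a) G" using G(3) ab by force+
  then have cardT: "card T = m + 3" using G(1,2) by (simp add: T_def)
  have deg: "degree Q = m + 3" using degree_unit_prod[OF T] cardT by (simp add: Q_def)
  have roots: "{x. poly Q x = 0} = (\<lambda>t. - 1 / t) ` T"
    using roots_unit_prod[OF T] by (simp add: Q_def)
  have inj: "inj_on abs {x. poly Q x = 0}"
    unfolding roots using G ab by (force simp: inj_on_def T_def abs_if)
  have dist: "distinct_root_moduli Q"
    unfolding distinct_root_moduli_def
    using inj rsquarefree_if_card_roots[OF _ card_roots_unit_prod[OF T]] by (simp add: Q_def)
  have posr: "{x. poly Q x = 0 \<and> x > 0} = {1 / b, 1 / a}"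
  proof -
    have "{x. poly Q x = 0 \<and> x > 0} = {x \<in> (\<lambda>t. - 1 / t) ` T. x > 0}" using roots by auto
    also have "\<dots> = {1 / b, 1 / a}" using G ab by (force simp: T_def)
    finally show ?thesis .
  qed
  have negr: "{x. poly Q x = 0 \<and> x < 0} = (\<lambda>g. - 1 / g) ` G"
  proof -
    have "{x. poly Q x = 0 \<and> x < 0} = {x \<in> (\<lambda>t. - 1 / t) ` T. x < 0}" using roots by auto
    also have "\<dots> = (\<lambda>g. - 1 / g) ` G" using G ab by (force simp: T_def)
    finally show ?thesis .
  qed
  define M where "M = (\<lambda>g. 1 / g) ` G"
  have cardM: "card M = m + 1"
    unfolding M_def using G by (subst card_image) (auto simp: inj_on_def)
  have "finite (ereal ` M)" "card (ereal ` M) = m + 1"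
    using G(1) cardM by (simp_all add: M_def card_image)
  then obtain f where f: "strict_mono_on {1..m + 1} f" "f ` {1..m + 1} = ereal ` M"
    using strict_mono_enumeration by metis
  \<comment> \<open>Extends the increasing enumeration of the moduli by the conventional values 0
    and infinity at the indices 0 and m + 2.\<close>
  define \<gamma> where "\<gamma> i = (if i = 0 then 0 else if i \<le> m + 1 then f i else \<infinity>)" for i
  have mono: "strict_mono_on {1..m + 1} \<gamma>"
    using f(1) by (auto simp: strict_mono_on_def \<gamma>_def)
  have img_M: "\<gamma> ` {1..m + 1} = ereal ` M"
    unfolding f(2)[symmetric] by (intro image_cong) (auto simp: \<gamma>_def)
  have img: "\<gamma> ` {1..m + 1} = (\<lambda>x. ereal \<bar>x\<bar>) ` {x. poly Q x = 0 \<and> x < 0}"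
    unfolding img_M negr M_def using G by (force simp: image_image)
  have inj_\<gamma>: "inj_on \<gamma> {1..m + 1}" using mono by (rule strict_mono_on_imp_inj_on)
  have count: "\<gamma> k < ereal (1 / c) \<and> ereal (1 / c) < \<gamma> (k + 1)"
    if c: "0 < c" "c \<notin> G" "card {g \<in> G. c < g} = k" for c k
  proof -
    have "\<gamma> ` {i \<in> {1..m + 1}. \<gamma> i < ereal (1 / c)} = {y \<in> ereal ` M. y < ereal (1 / c)}"
      unfolding img_M[symmetric] by blast
    also have "\<dots> = (\<lambda>g. ereal (1 / g)) ` {g \<in> G. c < g}"
      using G(3) c(1) by (auto simp: M_def field_simps)
    finally have "card (\<gamma> ` {i \<in> {1..m + 1}. \<gamma> i < ereal (1 / c)}) = card {g \<in> G. c < g}"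
      using G(3) by (simp add: card_image inj_on_def)
    moreover have "inj_on \<gamma> {i \<in> {1..m + 1}. \<gamma> i < ereal (1 / c)}"
      by (rule inj_on_subset[OF inj_\<gamma>]) auto
    ultimately have card: "card {i \<in> {1..m + 1}. \<gamma> i < ereal (1 / c)} = k"
      using c(3) by (simp add: card_image)
    have neq: "\<gamma> i \<noteq> ereal (1 / c)" if "i \<in> {1..m + 1}" for i
    proof
      assume "\<gamma> i = ereal (1 / c)"
      then have "ereal (1 / c) \<in> ereal ` M" using img_M that by (metis imageI)
      then show False using c G(3) by (auto simp: M_def)
    qed
    note * = strict_mono_below_card[OF mono neq card]
    have "k \<le> m + 1" using c(3) G(1,2) card_mono[of G "{g \<in> G. c < g}"] by auto
    \<comment> \<open>For k = 0 the lower bound, and for k = m + 1 the upper bound, comes from the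
      conventional values instead of the enumeration.\<close>
    then show ?thesis
      using * c(1) by (cases "k = 0"; cases "k = m + 1") (auto simp: \<gamma>_def)
  qed
  have d: "m + 2 + 2 - 1 = m + 3" "m + 3 - 2 = m + 1" "m + 3 - 1 = m + 2" by simp_all
  have \<gamma>: "\<gamma> 0 = 0" "\<gamma> (m + 2) = \<infinity>" by (auto simp: \<gamma>_def)
  have less: "1 / b < 1 / a" using ab by (simp add: frac_less2)
  have pos: "0 < b" using ab by simp
  show ?thesis
    unfolding realizable_def Let_def prod.case d
  proof (intro conjI exI[of _ Q])
    show "\<exists>\<beta> \<alpha> \<gamma>. \<beta> < \<alpha> \<and> {x. poly Q x = 0 \<and> x > 0} = {\<beta>, \<alpha>} \<and>
        strict_mono_on {1..m + 1} \<gamma> \<and>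
        \<gamma> ` {1..m + 1} = (\<lambda>x. ereal \<bar>x\<bar>) ` {x. poly Q x = 0 \<and> x < 0} \<and>
        \<gamma> 0 = 0 \<and> \<gamma> (m + 2) = \<infinity> \<and>
        \<gamma> u < ereal \<beta> \<and> ereal \<beta> < \<gamma> (u + 1) \<and>
        \<gamma> (u + v) < ereal \<alpha> \<and> ereal \<alpha> < \<gamma> (u + v + 1)"
      using less posr mono img \<gamma> count[OF pos G(5) u] count[OF ab(1) G(4) v] by blast
  qed (use assms(2) deg hyperbolic_unit_prod[OF T(1)] sgns dist in \<open>simp_all add: Q_def T_def\<close>)
qed

subsection \<open>Realizations\<close>

lemma realizing_coeff_sgn:
  assumes "realizing m u v a b G" "k < m + 4"
  shows "sgn (coeff (unit_prod (insert (-b) (insert (-a) G))) k) = (if k = 2 \<or> k = 3 then -1 else 1)"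
    and "degree (unit_prod (insert (-b) (insert (-a) G))) = m + 3"
proof -
  have ab: "0 < a" "a < b" and G: "finite G" "card G = m + 1" "\<forall>g\<in>G. 0 < g"
    and sgns: "sign_pattern (unit_prod (insert (-b) (insert (-a) G))) = Sigma_pattern m 2 2"
    using assms(1) by (auto simp: realizing_def)
  have "-a \<notin> G" "-b \<notin> insert (-a) G" "0 \<notin> insert (-b) (insert (-a) G)" using G(3) ab by force+
  then show deg: "degree (unit_prod (insert (-b) (insert (-a) G))) = m + 3"
    using G(1,2) by (simp add: degree_unit_prod)
  show "sgn (coeff (unit_prod (insert (-b) (insert (-a) G))) k) = (if k = 2 \<or> k = 3 then -1 else 1)"
    using sgns assms(2) unfolding sign_pattern_eq_iff[OF deg] by blast
qed

lemma realizing_insert: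
  assumes r: "realizing m u v a b G" and "1 \<le> m"
  shows "\<exists>g. realizing (m + 1) u v a b (insert g G)"
proof -
  have ab: "0 < a" "a < b" and G: "finite G" "card G = m + 1" "\<forall>g\<in>G. 0 < g" "a \<notin> G" "b \<notin> G"
    and uv: "card {g \<in> G. b < g} = u" "card {g \<in> G. a < g} = u + v"
    using r by (auto simp: realizing_def)
  let ?T = "insert (-b) (insert (-a) G)"
  define c where "c = coeff (unit_prod ?T)"
  have sgn_c: "sgn (c k) = (if k = 2 \<or> k = 3 then -1 else 1)" if "k < m + 4" for k
    unfolding c_def by (rule realizing_coeff_sgn[OF r that])
  have pos: "0 < c k" if "k < m + 4" "k \<noteq> 2" "k \<noteq> 3" for k
    using sgn_c[OF that(1)] that by (simp add: sgn_1_pos)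
  have neg: "c 2 < 0" "c 3 < 0"
    using sgn_c[of 2] sgn_c[of 3] by (simp_all add: sgn_1_neg)
  have c1: "0 < c 1" and c4: "0 < c 4" using pos[of 1] pos[of 4] \<open>1 \<le> m\<close> by simp_all
  \<comment> \<open>The new leading coefficient is thus epsilon times the old one, hence
    positive.\<close>
  have top: "c (m + 4) = 0"
    unfolding c_def using realizing_coeff_sgn(2)[OF r, of 0] by (intro coeff_eq_0) simp
  \<comment> \<open>Coefficient k + 1 becomes c_(k+1) + epsilon c_k. Only indices 2 and 4 combine
    opposite signs, and the two quotients are the thresholds there; c_4 > 0 uses m >= 1. Staying
    below a and below all of \<open>G\<close> keeps both counts and makes the element new.\<close>
  define S where "S = insert a (insert (- c 2 / c 1) (insert (c 4 / - c 3) G))"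
  have S: "finite S" "S \<noteq> {}" "\<forall>s\<in>S. 0 < s"
    using G ab neg c1 c4 by (auto simp: S_def divide_neg_pos divide_pos_neg)
  then have "0 < Min S" by simp
  then obtain \<epsilon> where \<epsilon>: "0 < \<epsilon>" "\<epsilon> < Min S" using dense by blast
  then have lt: "\<epsilon> < s" if "s \<in> S" for s using S that by auto
  have "\<epsilon> < - c 2 / c 1" "\<epsilon> < c 4 / - c 3" by (rule lt; simp add: S_def)+
  moreover have "0 < - c 3" using neg by simp
  ultimately have "\<epsilon> * c 1 < - c 2" "\<epsilon> * - c 3 < c 4"
    using c1 by (simp_all only: pos_less_divide_eq)
  then have e: "c 2 + \<epsilon> * c 1 < 0" "0 < c 4 + \<epsilon> * c 3" "\<epsilon> < a"
    using lt[of a] by (simp_all add: S_def)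
  have new: "\<epsilon> \<notin> G" using lt[of \<epsilon>] by (auto simp: S_def)
  have newT: "finite ?T" "\<epsilon> \<notin> ?T" using new G ab \<epsilon>(1) by auto
  let ?T' = "insert (-b) (insert (-a) (insert \<epsilon> G))"
  have T': "?T' = insert \<epsilon> ?T" by auto
  have c': "coeff (unit_prod ?T') (Suc k) = c (Suc k) + \<epsilon> * c k" for k
    unfolding T' coeff_unit_prod_insert[OF newT] by (simp add: c_def)
  have "-a \<notin> insert \<epsilon> G" "-b \<notin> insert (-a) (insert \<epsilon> G)" "0 \<notin> ?T'"
    using G(3) ab \<epsilon>(1) by force+
  then have deg: "degree (unit_prod ?T') = (m + 1) + 3"
    using G(1,2) new by (simp add: degree_unit_prod)
  have "sgn (coeff (unit_prod ?T') k) = (if k = 2 \<or> k = 3 then -1 else 1)" if k: "k < (m + 1) + 4" for k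
  proof -
    have "k = 0 \<or> k = Suc 0 \<or> k = Suc 1 \<or> k = Suc 2 \<or> k = Suc 3 \<or> (\<exists>j. k = Suc j \<and> 4 \<le> j)"
      by presburger
    then consider "k = 0" | "k = Suc 0" | "k = Suc 1" | "k = Suc 2" | "k = Suc 3"
      | j where "k = Suc j" "4 \<le> j" by blast
    then show ?thesis
    proof cases
      case 2
      then show ?thesis using c'[of 0] pos[of 0] c1 \<epsilon>(1) by (simp add: sgn_1_pos add_pos_pos)
    next
      case 3
      then show ?thesis using c'[of 1] e(1) by (simp add: sgn_1_neg numeral_2_eq_2)
    next
      case 4
      have "c 3 + \<epsilon> * c 2 < 0" using neg \<epsilon>(1) by (simp add: add_neg_neg mult_pos_neg)
      with 4 show ?thesis using c'[of 2] by (simp add: sgn_1_neg numeral_3_eq_3 numeral_2_eq_2)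
    next
      case 5
      then show ?thesis using c'[of 3] e(2) by (simp add: sgn_1_pos eval_nat_numeral)
    next
      case 6
      then have "0 < c j" using pos[of j] k by simp
      moreover have "0 \<le> c k" using pos[of k] top k 6 by (cases "k = m + 4") (auto simp: less_imp_le)
      ultimately show ?thesis using c'[of j] \<epsilon>(1) 6 by (simp add: sgn_1_pos add_nonneg_pos)
    qed simp
  qed
  then have "sign_pattern (unit_prod ?T') = Sigma_pattern (m + 1) 2 2"
    using sign_pattern_eq_iff[OF deg] by blast
  moreover have "{g \<in> insert \<epsilon> G. b < g} = {g \<in> G. b < g}" "{g \<in> insert \<epsilon> G. a < g} = {g \<in> G. a < g}"
    using e(3) ab by auto
  ultimately have "realizing (m + 1) u v a b (insert \<epsilon> G)"
    unfolding realizing_def using ab G uv new e(3) \<epsilon>(1) by simp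
  then show ?thesis ..
qed

text \<open>Lists make every condition on a concrete witness computable by simplification.\<close>

lemma realizing_listI:
  assumes "0 < a" "a < b" "distinct gs" "length gs = m + 1" "\<forall>g\<in>set gs. 0 < g \<and> g \<noteq> a \<and> g \<noteq> b"
    and "length (filter (\<lambda>g. b < g) gs) = u" "length (filter (\<lambda>g. a < g) gs) = u + v"
    and "sign_pattern (foldr (\<lambda>t p. [:1, t:] * p) (-b # -a # gs) 1) = Sigma_pattern m 2 2"
  shows "realizing m u v a b (set gs)"
proof -
  have prod: "unit_prod (set ts) = foldr (\<lambda>t p. [:1, t:] * p) ts 1" if "distinct ts" for ts
    using that
    by (induction ts) (simp_all add: unit_prod_insert del: mult_pCons_left)
  have "distinct (-b # -a # gs)" using assms(1-3,5) by force
  from prod[OF this] have "sign_pattern (unit_prod (insert (-b) (insert (-a) (set gs)))) = Sigma_pattern m 2 2"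
    using assms(8) by simp
  moreover have "card {g \<in> set gs. P g} = length (filter P gs)" for P
    using distinct_length_filter[OF assms(3), of P] by (simp add: Int_def conj_commute)
  ultimately show ?thesis
    using assms distinct_card[OF assms(3)] unfolding realizing_def by auto
qed

text \<open>Rescaling x by a positive factor changes neither signs nor order, so integer reciprocals
  of moduli can serve as witnesses.\<close>

lemma realizing_degree_6:
  assumes "u + v \<le> 3 \<or> (u, v) = (0, 4)"
  shows "\<exists>a b G. realizing 3 u v a b G"
proof -
  note eval = one_pCons sign_pattern_def Sigma_pattern_def numeral_eq_Suc
  have "realizing 3 0 0 6 7 (set [2, 3, 4, 5])"
    by (rule realizing_listI) (simp_all add: eval)
  moreover
  have "realizing 3 0 1 4 6 (set [1, 2, 3, 5])"
    by (rule realizing_listI) (simp_all add: eval)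
  moreover
  have "realizing 3 0 2 3 6 (set [1, 2, 4, 5])"
    by (rule realizing_listI) (simp_all add: eval)
  moreover
  have "realizing 3 0 3 3 7 (set [1, 4, 5, 6])"
    by (rule realizing_listI) (simp_all add: eval)
  moreover
  \<comment> \<open>All four elements lie just above a = 12. Then c_1 = 46 - b and c_4 = 2986 b -
    101784, so b must lie between about 34.1 and 46.\<close>
  have "realizing 3 0 4 12 35 (set [13, 14, 15, 16])"
    by (rule realizing_listI) (simp_all add: eval)
  moreover
  have "realizing 3 1 0 4 5 (set [1, 2, 3, 6])"
    by (rule realizing_listI) (simp_all add: eval)
  moreover
  have "realizing 3 1 1 3 5 (set [1, 2, 4, 6])"
    by (rule realizing_listI) (simp_all add: eval)
  moreover
  have "realizing 3 1 2 4 7 (set [1, 5, 6, 8])"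
    by (rule realizing_listI) (simp_all add: eval)
  moreover
  have "realizing 3 2 0 3 4 (set [1, 2, 5, 6])"
    by (rule realizing_listI) (simp_all add: eval)
  moreover
  have "realizing 3 2 1 5 7 (set [1, 6, 8, 9])"
    by (rule realizing_listI) (simp_all add: eval)
  moreover
  have "realizing 3 3 0 7 8 (set [1, 9, 10, 11])"
    by (rule realizing_listI) (simp_all add: eval)
  moreover have "(u, v) = (0, 0) \<or> (u, v) = (0, 1) \<or> (u, v) = (0, 2) \<or> (u, v) = (0, 3) \<or>
      (u, v) = (0, 4) \<or> (u, v) = (1, 0) \<or> (u, v) = (1, 1) \<or> (u, v) = (1, 2) \<or>
      (u, v) = (2, 0) \<or> (u, v) = (2, 1) \<or> (u, v) = (3, 0)"
    using assms unfolding prod.inject by presburger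
  ultimately show ?thesis by blast
qed

text \<open>Starts at m = 3 and inserts m - 3 small elements; u and v stay fixed, so w absorbs the
  growth.\<close>

lemma realizable_from_degree_6:
  assumes "u + v \<le> 3 \<or> (u, v) = (0, 4)" "3 \<le> m" "u + v + w = m + 1"
  shows "realizable m 2 2 (u, v, w)"
proof -
  have "\<exists>a b G. realizing (3 + j) u v a b G" for j
  proof (induction j)
    case 0
    show ?case using realizing_degree_6[OF assms(1)] by simp
  next
    case (Suc j)
    then show ?case using realizing_insert[of "3 + j"] by fastforce
  qed
  from this[of "m - 3"] show ?thesis
    using assms(2,3) realizing_imp_realizable by auto
qed

section \<open>Necessary conditions and the number of triples\<close>

lemma realizable_imp_bound:
  assumes "realizable m 2 2 (u, v, w)" "1 \<le> m"
  shows "u + v + w = m + 1" "u + v \<le> 4" "1 \<le> u \<Longrightarrow> u + v \<le> 3"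
proof -
  from realizable_imp_realizing[OF assms(1)] obtain a b G
    where sum: "u + v + w = m + 1" and r: "realizing m u v a b G" by blast
  show "u + v + w = m + 1" by (rule sum)
  have ab: "0 < a" "a < b" and G: "finite G" "\<And>g. g \<in> G \<Longrightarrow> 0 < g"
    and uv: "card {g \<in> G. b < g} = u" "card {g \<in> G. a < g} = u + v"
    using r by (auto simp: realizing_def)
  let ?c = "coeff (unit_prod (insert (-b) (insert (-a) G)))"
  have c: "?c 2 < 0" "?c 3 < 0" "0 < ?c 4"
    using realizing_coeff_sgn(1)[OF r, of 2] realizing_coeff_sgn(1)[OF r, of 3]
      realizing_coeff_sgn(1)[OF r, of 4] \<open>1 \<le> m\<close>
    by (simp_all add: sgn_1_neg sgn_1_pos)
  show "u + v \<le> 4"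
    using card_above_small_le_4[OF G ab c(2,3)] unfolding uv .
  show "u + v \<le> 3" if "1 \<le> u"
  proof -
    \<comment> \<open>A positive u supplies an element above b, as the second obstruction
      requires.\<close>
    from that uv(1) have "{g \<in> G. b < g} \<noteq> {}" by (metis card.empty not_one_le_zero)
    then obtain g where "g \<in> G" "b < g" by blast
    from card_above_small_neq_4[OF G ab this c(1,3)] show ?thesis unfolding uv by simp
  qed
qed

text \<open>The pair (u, v) determines w, and n <= N ensures that the truncated subtraction N - u -
  v is exact.\<close>

lemma card_triples:
  fixes n N :: nat
  assumes "n \<le> N"
  shows "card {(u, v, w). u + v + w = N \<and> u + v \<le> n} = (\<Sum>u\<le>n. n - u + 1)"
proof -
  have "{(u, v, w). u + v + w = N \<and> u + v \<le> n} = (\<lambda>(u, v). (u, v, N - u - v)) ` (SIGMA u:{..n}. {..n - u})"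
    using assms by (auto simp: image_iff)
  also have "card \<dots> = card (SIGMA u:{..n}. {..n - u})"
    by (rule card_image) (auto simp: inj_on_def)
  finally show ?thesis by simp
qed

theorem theorem1:
  fixes m d :: nat
  assumes "d = m + 3"
  shows
    "(d \<ge> 7 \<longrightarrow>
        (\<forall>u v w. realizable m 2 2 (u, v, w) \<longrightarrow> w \<ge> m - 3) \<and>
        card {(u, v, w). u + v + w = d - 2 \<and> w \<ge> m - 3} = 15) \<and>
     (d \<ge> 6 \<longrightarrow>
        card {(u, v, w). u + v + w = d - 2 \<and> u + v \<le> 3} = 10 \<and>
        (\<forall>u v w. u + v + w = d - 2 \<and> u + v \<le> 3 \<longrightarrow> realizable m 2 2 (u, v, w)) \<and>
        realizable m 2 2 (0, 4, m - 3)) \<and>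
     (d \<ge> 6 \<longrightarrow>
        \<not> realizable m 2 2 (4, 0, m - 3) \<and>
        \<not> realizable m 2 2 (3, 1, m - 3) \<and>
        \<not> realizable m 2 2 (2, 2, m - 3) \<and>
        \<not> realizable m 2 2 (1, 3, m - 3))"
proof (intro conjI impI allI)
  assume "d \<ge> 7"
  then have m: "4 \<le> m" using assms by simp
  show "w \<ge> m - 3" if "realizable m 2 2 (u, v, w)" for u v w
    using realizable_imp_bound(1,2)[OF that] m by linarith
  \<comment> \<open>Since the sum is m + 1, the condition on w says u + v <= 4; the count is then 5
    + 4 + 3 + 2 + 1.\<close>
  have "{(u, v, w). u + v + w = d - 2 \<and> w \<ge> m - 3} = {(u, v, w). u + v + w = m + 1 \<and> u + v \<le> 4}"
    using assms m by auto
  then show "card {(u, v, w). u + v + w = d - 2 \<and> w \<ge> m - 3} = 15"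
    using card_triples[of 4 "m + 1"] m by (simp add: eval_nat_numeral)
next
  assume "d \<ge> 6"
  then have m: "3 \<le> m" and d: "d - 2 = m + 1" using assms by simp_all
  show "card {(u, v, w). u + v + w = d - 2 \<and> u + v \<le> 3} = 10"
    unfolding d using card_triples[of 3 "m + 1"] m by (simp add: eval_nat_numeral)
  show "realizable m 2 2 (u, v, w)" if "u + v + w = d - 2 \<and> u + v \<le> 3" for u v w
    using that m unfolding d by (intro realizable_from_degree_6) auto
  show "realizable m 2 2 (0, 4, m - 3)"
    using m by (intro realizable_from_degree_6) auto
  \<comment> \<open>All four triples have u >= 1 and u + v = 4.\<close>
  show "\<not> realizable m 2 2 (4, 0, m - 3)" "\<not> realizable m 2 2 (3, 1, m - 3)"
    "\<not> realizable m 2 2 (2, 2, m - 3)" "\<not> realizable m 2 2 (1, 3, m - 3)"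
    using realizable_imp_bound(3) m by fastforce+
qed

end
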